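(* Let $G\subsetneq\mathbb{R}^n$ be a domain. Then for all $z\in G$ and all $r\in(0,1]$, the triangular ratio metric ball $B_s(z,r)=\{y\in G: s_G(z,y)<r\}$ is (Euclidean) starlike with respect to $z$, i.e. for every $y\in B_s(z,r)$ the Euclidean segment $[z,y]$ is contained in $B_s(z,r)$.
   Context: A domain is a nonempty open connected set. For a domain $G\subsetneq\mathbb{R}^n$ and $x,y\in G$, the triangular ratio metric is $$s_G(x,y)=\sup_{z\in\partial G}\frac{|x-y|}{|x-z|+|z-y|}\in[0,1],$$ where $|\cdot|$ is the Euclidean norm. The segment is $[x,y]=\{(1-t)x+ty: 0\le t\le 1\}$. *)

theory Defs
  imports "HOL-Analysis.Analysis"
begin

(* The supremum is taken in the reals.  For a nonempty open G different from the whole space and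
   x, y in G, the boundary is nonempty, every denominator is positive (boundary points lie
   outside G), and all quotients lie in [0,1]; so it is a genuine least upper bound. *)
definition triangular_ratio_metric ::
    "(real ^ 'n) set \<Rightarrow> real ^ 'n \<Rightarrow> real ^ 'n \<Rightarrow> real" where
  "triangular_ratio_metric G x y =
     (SUP z\<in>frontier G. norm (x - y) / (norm (x - z) + norm (z - y)))"

definition triangular_ratio_ball ::
    "(real ^ 'n) set \<Rightarrow> real ^ 'n \<Rightarrow> real \<Rightarrow> (real ^ 'n) set" where
  "triangular_ratio_ball G z r = {y \<in> G. triangular_ratio_metric G z y < r}"

(* The library's starlike leaves the centre existentially quantified; here it is prescribed. *)
definition starlike_wrt :: "'a::real_vector set \<Rightarrow> 'a \<Rightarrow> bool" where
  "starlike_wrt S a \<longleftrightarrow> (\<forall>x\<in>S. closed_segment a x \<subseteq> S)"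

end

theory Submission
  imports Defs
begin

text \<open>For a fixed boundary point \<open>w\<close>, the quotient \<open>|z - y| / (|z - w| + |w - y|)\<close> is monotone as \<open>y\<close>
  moves away from \<open>z\<close> along a ray: prolonging the segment by \<open>b\<close> adds \<open>b\<close> to the numerator and at
  most \<open>b\<close> to the denominator, and the quotient is at most 1. Moreover the quotient is 1 when \<open>w\<close>
  lies on the segment from \<open>z\<close> to \<open>y\<close>, so for \<open>r \<le> 1\<close> this segment cannot leave \<open>G\<close>.\<close>

lemma triangular_ratio_le_1:
  fixes x y w :: "'a::real_normed_vector"
  shows "norm (x - y) / (norm (x - w) + norm (w - y)) \<le> 1"
  using norm_triangle_ineq[of "x - w" "w - y"] by (simp add: divide_le_eq_1) (smt (verit) norm_ge_zero)

lemma bdd_above_triangular_ratio: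
  fixes x y :: "'a::real_normed_vector"
  shows "bdd_above ((\<lambda>w. norm (x - y) / (norm (x - w) + norm (w - y))) ` S)"
  by (rule bdd_aboveI2[where M = 1]) (rule triangular_ratio_le_1)

lemma triangular_ratio_mono_segment:
  fixes z y u w :: "'a::euclidean_space"
  assumes "u \<in> closed_segment z y" and "w \<noteq> z"
  shows "norm (z - u) / (norm (z - w) + norm (w - u))
    \<le> norm (z - y) / (norm (z - w) + norm (w - y))"
proof -
  define a b D E where "a = norm (z - u)" and "b = norm (u - y)"
    and "D = norm (z - w) + norm (w - u)" and "E = norm (z - w) + norm (w - y)"
  have ab: "norm (z - y) = a + b"
    using assms(1) by (simp add: between_mem_segment[symmetric] between dist_norm a_def b_def)
  have pos: "0 < D" "0 < E" "0 \<le> b"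
    using assms(2) by (simp_all add: D_def E_def b_def add_pos_nonneg)
  have "a \<le> D"
    using norm_triangle_ineq[of "z - w" "w - u"] by (simp add: a_def D_def)
  have "E \<le> D + b"
    using norm_triangle_ineq[of "w - u" "u - y"] by (simp add: D_def E_def b_def)
  have "0 \<le> a" by (simp add: a_def)
  \<comment> \<open>The quotient inequality is proved in cross-multiplied form; after cancelling
    \<open>a * D\<close>, what remains is \<open>a * b \<le> b * D\<close>, that is,
    \<open>a \<le> D\<close> scaled by \<open>b\<close>.\<close>
  have "a * E \<le> a * (D + b)"
    using \<open>E \<le> D + b\<close> \<open>0 \<le> a\<close> by (rule mult_left_mono)
  also have "\<dots> \<le> (a + b) * D"
    using mult_right_mono[OF \<open>a \<le> D\<close> pos(3)] by (simp add: algebra_simps)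
  finally have "a / D \<le> (a + b) / E"
    using pos by (simp add: divide_simps)
  then show ?thesis
    by (simp add: ab a_def D_def E_def)
qed

lemma triangular_ratio_metric_upper:
  assumes "w \<in> frontier G"
  shows "norm (x - y) / (norm (x - w) + norm (w - y)) \<le> triangular_ratio_metric G x y"
  unfolding triangular_ratio_metric_def
  using assms by (intro cSUP_upper bdd_above_triangular_ratio)

text \<open>The pointwise inequality passes to the supremum. A nonempty frontier keeps the real
  supremum from being taken over the empty set, and \<open>z\<close> off the frontier makes every
  denominator positive.\<close>

lemma triangular_ratio_metric_mono_segment:
  assumes "frontier G \<noteq> {}" and "z \<notin> frontier G" and "u \<in> closed_segment z y"
  shows "triangular_ratio_metric G z u \<le> triangular_ratio_metric G z y"
  unfolding triangular_ratio_metric_def[of G z u]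
proof (rule cSUP_least[OF assms(1)])
  fix w assume w: "w \<in> frontier G"
  then have "w \<noteq> z" using assms(2) by auto
  from triangular_ratio_mono_segment[OF assms(3) this] triangular_ratio_metric_upper[OF w]
  show "norm (z - u) / (norm (z - w) + norm (w - u)) \<le> triangular_ratio_metric G z y"
    by (rule order_trans)
qed

text \<open>A segment is connected, so one that starts in \<open>G\<close> and leaves it meets the
  frontier; such a point gives equality in the triangle inequality.\<close>

lemma closed_segment_subset_if_triangular_ratio_lt_1:
  assumes "z \<in> G" and "z \<notin> frontier G" and "triangular_ratio_metric G z y < 1"
  shows "closed_segment z y \<subseteq> G"
proof (rule ccontr)
  assume "\<not> closed_segment z y \<subseteq> G"
  then obtain w where w: "w \<in> closed_segment z y" "w \<in> frontier G"
    using connected_Int_frontier[of "closed_segment z y" G] assms(1) by auto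
  then have "norm (z - w) + norm (w - y) = norm (z - y)"
    by (simp add: between_mem_segment[symmetric] between dist_norm)
  \<comment> \<open>Without this the quotient at \<open>w\<close> would be 0/0, which evaluates to 0
    instead of 1. If \<open>z = y\<close>, the segment is a single point and \<open>w = z\<close>
    would lie on the frontier.\<close>
  moreover have "z \<noteq> y"
    using w assms(2) by auto
  ultimately have "1 \<le> triangular_ratio_metric G z y"
    using triangular_ratio_metric_upper[OF w(2), of z y] by simp
  then show False
    using assms(3) by simp
qed

theorem theorem1p2:
  fixes G :: "(real ^ 'n) set"
  assumes "G \<noteq> {}" and "open G" and "connected G" and "G \<noteq> UNIV"
  shows "\<forall>z\<in>G. \<forall>r\<in>{0<..1}. starlike_wrt (triangular_ratio_ball G z r) z"
proof (intro ballI)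
  fix z r assume z: "z \<in> G" and r: "r \<in> {0<..1::real}"
  have fr: "frontier G \<noteq> {}"
    using frontier_not_empty assms(1,4) by blast
  have zf: "z \<notin> frontier G"
    using z assms(2) by (simp add: frontier_def interior_open)
  show "starlike_wrt (triangular_ratio_ball G z r) z"
    unfolding starlike_wrt_def
  proof (intro ballI subsetI)
    fix y u assume y: "y \<in> triangular_ratio_ball G z r" and u: "u \<in> closed_segment z y"
    have s: "triangular_ratio_metric G z y < r"
      using y by (simp add: triangular_ratio_ball_def)
    \<comment> \<open>Here \<open>r \<le> 1\<close> enters: it turns the bound by \<open>r\<close>
      into a bound by 1.\<close>
    then have "u \<in> G"
      using closed_segment_subset_if_triangular_ratio_lt_1[OF z zf, of y] r u by auto
    moreover have "triangular_ratio_metric G z u < r"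
      using triangular_ratio_metric_mono_segment[OF fr zf u] s by simp
    ultimately show "u \<in> triangular_ratio_ball G z r"
      by (simp add: triangular_ratio_ball_def)
  qed
qed

end
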